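(* The variety $\mathsf{SRL}$ of semiunilinear residuated lattices (the variety generated by the class $\mathsf{URL}$ of unilinear residuated lattices) is axiomatized, relative to the variety of residuated lattices, by the infinitely many equations $$1=\gamma_1(x\backslash y)\vee\gamma_2(y\backslash x)\vee\gamma_3((x\wedge y)\backslash z),\qquad 1=\gamma_4(x\backslash y)\vee\gamma_5(y\backslash x)\vee\gamma_6(w\backslash(x\vee y)),$$ where $\gamma_1,\dots,\gamma_6$ range over all iterated conjugates in $\Gamma(Var)$.
   Context: A residuated lattice is an algebra $(R,\wedge,\vee,\cdot,\backslash,/,1)$ such that $(R,\wedge,\vee)$ is a lattice, $(R,\cdot,1)$ is a monoid, and for all $x,y,z\in R$: $xy\le z \iff y\le x\backslash z \iff x\le z/y$. A residuated lattice is unilinear if it satisfies $\forall u_1,u_2,z,w\,(u_1\le u_2 \text{ or } u_2\le u_1 \text{ or } (u_1\wedge u_2\le w \text{ and } z\le u_1\vee u_2))$; $\mathsf{URL}$ is the class of all of these. The left conjugate of a term $a$ by $x$ is $(x\backslash ax)\wedge 1$ and the right conjugate is $(xa/x)\wedge 1$. An iterated conjugate is a (nonempty) composition of left and right conjugations by various conjugating elements taken from a countably infinite set $Var$ of variables; $\Gamma(Var)$ is the set of all iterated conjugates, viewed as unary operations $a\mapsto\gamma(a)$ on terms. *)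

theory Defs
  imports "HOL-Algebra.Group" "HOL-Library.Countable_Set"
begin

section \<open>Algebras in the signature of residuated lattices\<close>

text \<open>\<open>lres A x z\<close> is $x\backslash z$ and \<open>rres A z y\<close> is $z/y$.\<close>

record 'u rl = "'u monoid" +
  rmeet :: "'u \<Rightarrow> 'u \<Rightarrow> 'u"
  rjoin :: "'u \<Rightarrow> 'u \<Rightarrow> 'u"
  lres :: "'u \<Rightarrow> 'u \<Rightarrow> 'u"
  rres :: "'u \<Rightarrow> 'u \<Rightarrow> 'u"

definition rl_algebra :: "'u rl \<Rightarrow> bool" where
  "rl_algebra A \<longleftrightarrow> \<one>\<^bsub>A\<^esub> \<in> carrier A \<and>
     (\<forall>x\<in>carrier A. \<forall>y\<in>carrier A.
        x \<otimes>\<^bsub>A\<^esub> y \<in> carrier A \<and> rmeet A x y \<in> carrier A \<and> rjoin A x y \<in> carrier A \<and>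
        lres A x y \<in> carrier A \<and> rres A x y \<in> carrier A)"

definition lattice_laws :: "'u rl \<Rightarrow> bool" where
  "lattice_laws A \<longleftrightarrow>
     (\<forall>x\<in>carrier A. \<forall>y\<in>carrier A. \<forall>z\<in>carrier A.
        rmeet A x y = rmeet A y x \<and> rjoin A x y = rjoin A y x \<and>
        rmeet A (rmeet A x y) z = rmeet A x (rmeet A y z) \<and>
        rjoin A (rjoin A x y) z = rjoin A x (rjoin A y z) \<and>
        rmeet A x (rjoin A x y) = x \<and> rjoin A x (rmeet A x y) = x)"

definition rle :: "'u rl \<Rightarrow> 'u \<Rightarrow> 'u \<Rightarrow> bool" where
  "rle A x y \<longleftrightarrow> rmeet A x y = x"

definition RL :: "'u rl set" where
  "RL = {A. rl_algebra A \<and> lattice_laws A \<and> monoid A \<and>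
     (\<forall>x\<in>carrier A. \<forall>y\<in>carrier A. \<forall>z\<in>carrier A.
        (rle A (x \<otimes>\<^bsub>A\<^esub> y) z \<longleftrightarrow> rle A y (lres A x z)) \<and>
        (rle A (x \<otimes>\<^bsub>A\<^esub> y) z \<longleftrightarrow> rle A x (rres A z y)))}"

definition URL :: "'u rl set" where
  "URL = {A \<in> RL.
     \<forall>u1\<in>carrier A. \<forall>u2\<in>carrier A. \<forall>z\<in>carrier A. \<forall>w\<in>carrier A.
        rle A u1 u2 \<or> rle A u2 u1 \<or> (rle A (rmeet A u1 u2) w \<and> rle A z (rjoin A u1 u2))}"


section \<open>Terms, equations, varieties\<close>

datatype trm = Var nat | One | Mult trm trm | Meet trm trm | Join trm trm
  | LRes trm trm | RRes trm trm

primrec eval :: "'u rl \<Rightarrow> (nat \<Rightarrow> 'u) \<Rightarrow> trm \<Rightarrow> 'u" where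
  "eval A \<rho> (Var n) = \<rho> n"
| "eval A \<rho> One = \<one>\<^bsub>A\<^esub>"
| "eval A \<rho> (Mult s t) = eval A \<rho> s \<otimes>\<^bsub>A\<^esub> eval A \<rho> t"
| "eval A \<rho> (Meet s t) = rmeet A (eval A \<rho> s) (eval A \<rho> t)"
| "eval A \<rho> (Join s t) = rjoin A (eval A \<rho> s) (eval A \<rho> t)"
| "eval A \<rho> (LRes s t) = lres A (eval A \<rho> s) (eval A \<rho> t)"
| "eval A \<rho> (RRes s t) = rres A (eval A \<rho> s) (eval A \<rho> t)"

type_synonym equation = "trm \<times> trm"

definition satisfies :: "'u rl \<Rightarrow> equation \<Rightarrow> bool" where
  "satisfies A e \<longleftrightarrow>
     (\<forall>\<rho>. (\<forall>n. \<rho> n \<in> carrier A) \<longrightarrow> eval A \<rho> (fst e) = eval A \<rho> (snd e))"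

definition Mod :: "equation set \<Rightarrow> 'u rl set" where
  "Mod E = {A. rl_algebra A \<and> (\<forall>e\<in>E. satisfies A e)}"

text \<open>
  A variety is an equational class.  Classes of algebras are taken inside a universe \<open>'u\<close>: the
  carrier of an algebra may be any nonempty subset of \<open>'u\<close>.  When \<open>'u\<close> is infinite, this
  loses nothing: by \<open>URL_refute_in_universe\<close> below, the equations valid in the unilinear
  residuated lattices inside \<open>'u\<close> are exactly those valid in all unilinear residuated lattices,
  whatever the type of their elements.
\<close>

definition variety :: "'u rl set \<Rightarrow> bool" where
  "variety V \<longleftrightarrow> (\<exists>E. V = Mod E)"

definition generated_variety :: "'u rl set \<Rightarrow> 'u rl set" where
  "generated_variety K = \<Inter>{V. variety V \<and> K \<subseteq> V}"

definition SRL :: "'u rl set" where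
  "SRL = generated_variety URL"


section \<open>Iterated conjugates and the equations\<close>

definition lconj :: "trm \<Rightarrow> trm \<Rightarrow> trm" where
  "lconj x a = Meet (LRes x (Mult a x)) One"

definition rconj :: "trm \<Rightarrow> trm \<Rightarrow> trm" where
  "rconj x a = Meet (RRes (Mult x a) x) One"

inductive_set iterated_conjugates :: "(trm \<Rightarrow> trm) set" where
  left: "lconj (Var n) \<in> iterated_conjugates"
| right: "rconj (Var n) \<in> iterated_conjugates"
| comp: "f \<in> iterated_conjugates \<Longrightarrow> g \<in> iterated_conjugates \<Longrightarrow> f \<circ> g \<in> iterated_conjugates"

text \<open>
  The variables $x, y, z, w$ are \<open>Var 0\<close>, \<open>Var 1\<close>, \<open>Var 2\<close>, \<open>Var 3\<close>; they may also occur as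
  conjugating variables.
\<close>

definition srl_equation1 :: "(trm \<Rightarrow> trm) \<Rightarrow> (trm \<Rightarrow> trm) \<Rightarrow> (trm \<Rightarrow> trm) \<Rightarrow> equation" where
  "srl_equation1 \<gamma>1 \<gamma>2 \<gamma>3 = (let x = Var 0; y = Var 1; z = Var 2 in
     (One, Join (Join (\<gamma>1 (LRes x y)) (\<gamma>2 (LRes y x))) (\<gamma>3 (LRes (Meet x y) z))))"

definition srl_equation2 :: "(trm \<Rightarrow> trm) \<Rightarrow> (trm \<Rightarrow> trm) \<Rightarrow> (trm \<Rightarrow> trm) \<Rightarrow> equation" where
  "srl_equation2 \<gamma>4 \<gamma>5 \<gamma>6 = (let x = Var 0; y = Var 1; w = Var 3 in
     (One, Join (Join (\<gamma>4 (LRes x y)) (\<gamma>5 (LRes y x))) (\<gamma>6 (LRes w (Join x y)))))"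

definition srl_equations :: "equation set" where
  "srl_equations =
     {srl_equation1 \<gamma>1 \<gamma>2 \<gamma>3 | \<gamma>1 \<gamma>2 \<gamma>3.
        \<gamma>1 \<in> iterated_conjugates \<and> \<gamma>2 \<in> iterated_conjugates \<and> \<gamma>3 \<in> iterated_conjugates} \<union>
     {srl_equation2 \<gamma>4 \<gamma>5 \<gamma>6 | \<gamma>4 \<gamma>5 \<gamma>6.
        \<gamma>4 \<in> iterated_conjugates \<and> \<gamma>5 \<in> iterated_conjugates \<and> \<gamma>6 \<in> iterated_conjugates}"


section \<open>Independence of the universe\<close>

instance trm :: countable
  by countable_datatype

lemma eval_in_carrier:
  assumes "rl_algebra A" "\<forall>n. \<rho> n \<in> carrier A"
  shows "eval A \<rho> t \<in> carrier A"
  using assms by (induction t) (auto simp: rl_algebra_def)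

lemma URL_refute_in_universe:
  fixes B :: "'v rl"
  assumes inf: "infinite (UNIV :: 'u set)"
    and B: "B \<in> URL" and fail: "\<not> satisfies B e"
  shows "\<exists>C :: 'u rl. C \<in> URL \<and> \<not> satisfies C e"
proof -
  obtain \<rho> where \<rho>: "\<forall>n. \<rho> n \<in> carrier B"
    and ne: "eval B \<rho> (fst e) \<noteq> eval B \<rho> (snd e)"
    using fail by (auto simp: satisfies_def)
  have alg: "rl_algebra B" and lat: "lattice_laws B" and mon: "monoid B"
    using B by (auto simp: URL_def RL_def)
  have res: "(rle B (x \<otimes>\<^bsub>B\<^esub> y) z \<longleftrightarrow> rle B y (lres B x z)) \<and>
        (rle B (x \<otimes>\<^bsub>B\<^esub> y) z \<longleftrightarrow> rle B x (rres B z y))"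
    if "x \<in> carrier B" "y \<in> carrier B" "z \<in> carrier B" for x y z
    using B that by (auto simp: URL_def RL_def)
  have uni: "rle B u1 u2 \<or> rle B u2 u1 \<or> (rle B (rmeet B u1 u2) w \<and> rle B z (rjoin B u1 u2))"
    if "u1 \<in> carrier B" "u2 \<in> carrier B" "z \<in> carrier B" "w \<in> carrier B" for u1 u2 z w
    using B that by (auto simp: URL_def)
  define S where "S = range (eval B \<rho>)"
  have SB: "S \<subseteq> carrier B"
    using eval_in_carrier[OF alg \<rho>] by (auto simp: S_def)
  have inS: "eval B \<rho> t \<in> S" for t
    by (simp add: S_def)
  have S_one: "\<one>\<^bsub>B\<^esub> \<in> S"
    using inS[of One] by simp
  have S_ops: "x \<otimes>\<^bsub>B\<^esub> y \<in> S" "rmeet B x y \<in> S" "rjoin B x y \<in> S" "lres B x y \<in> S" "rres B x y \<in> S"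
    if xy: "x \<in> S" "y \<in> S" for x y
  proof -
    obtain s t where "x = eval B \<rho> s" "y = eval B \<rho> t"
      using xy by (auto simp: S_def)
    then show "x \<otimes>\<^bsub>B\<^esub> y \<in> S" "rmeet B x y \<in> S" "rjoin B x y \<in> S" "lres B x y \<in> S" "rres B x y \<in> S"
      using inS[of "Mult s t"] inS[of "Meet s t"] inS[of "Join s t"] inS[of "LRes s t"]
        inS[of "RRes s t"] by simp_all
  qed
  have "countable S"
    unfolding S_def by simp
  then obtain k :: "'v \<Rightarrow> nat" where k: "inj_on k S"
    by (auto simp: countable_def)
  obtain j :: "nat \<Rightarrow> 'u" where j: "inj j"
    using inf infinite_countable_subset by blast
  define f where "f = j \<circ> k"
  have f: "inj_on f S"
    unfolding f_def using k j by (meson comp_inj_on inj_on_subset subset_UNIV)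
  define g where "g = inv_into S f"
  have gf [simp]: "g (f a) = a" if "a \<in> S" for a
    using f that by (simp add: g_def)
  have f_eq [simp]: "f a = f b \<longleftrightarrow> a = b" if "a \<in> S" "b \<in> S" for a b
    using f that by (meson inj_onD)
  define C :: "'u rl" where
    "C = \<lparr>carrier = f ` S, mult = (\<lambda>x y. f (g x \<otimes>\<^bsub>B\<^esub> g y)), one = f \<one>\<^bsub>B\<^esub>,
          rmeet = (\<lambda>x y. f (rmeet B (g x) (g y))), rjoin = (\<lambda>x y. f (rjoin B (g x) (g y))),
          lres = (\<lambda>x y. f (lres B (g x) (g y))), rres = (\<lambda>x y. f (rres B (g x) (g y)))\<rparr>"
  have C_simps [simp]: "carrier C = f ` S" "x \<otimes>\<^bsub>C\<^esub> y = f (g x \<otimes>\<^bsub>B\<^esub> g y)" "\<one>\<^bsub>C\<^esub> = f \<one>\<^bsub>B\<^esub>"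
    "rmeet C x y = f (rmeet B (g x) (g y))" "rjoin C x y = f (rjoin B (g x) (g y))"
    "lres C x y = f (lres B (g x) (g y))" "rres C x y = f (rres B (g x) (g y))" for x y
    by (simp_all add: C_def)
  note S_ops [simp] S_one [simp]
  have SB' [simp]: "a \<in> carrier B" if "a \<in> S" for a
    using SB that by auto
  have rle_C [simp]: "rle C (f a) (f b) \<longleftrightarrow> rle B a b" if "a \<in> S" "b \<in> S" for a b
    using that by (simp add: rle_def)
  have "rl_algebra C"
    by (auto simp: rl_algebra_def)
  moreover have "lattice_laws C"
    unfolding lattice_laws_def
  proof (unfold C_simps(1), intro ballI, elim imageE)
    fix x y z a b c
    assume xyz: "x = f a" "y = f b" "z = f c" and abc: "a \<in> S" "b \<in> S" "c \<in> S"
    from abc have laws: "rmeet B a b = rmeet B b a \<and> rjoin B a b = rjoin B b a \<and>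
        rmeet B (rmeet B a b) c = rmeet B a (rmeet B b c) \<and>
        rjoin B (rjoin B a b) c = rjoin B a (rjoin B b c) \<and>
        rmeet B a (rjoin B a b) = a \<and> rjoin B a (rmeet B a b) = a"
      using lat SB' unfolding lattice_laws_def by blast
    show "rmeet C x y = rmeet C y x \<and> rjoin C x y = rjoin C y x \<and>
        rmeet C (rmeet C x y) z = rmeet C x (rmeet C y z) \<and>
        rjoin C (rjoin C x y) z = rjoin C x (rjoin C y z) \<and>
        rmeet C x (rjoin C x y) = x \<and> rjoin C x (rmeet C x y) = x"
      by (simp only: xyz abc C_simps gf S_ops f_eq) (rule laws)
  qed
  moreover have "monoid C"
    by (rule monoidI) (auto simp: monoid.m_assoc[OF mon] monoid.l_one[OF mon] monoid.r_one[OF mon])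
  moreover have "\<forall>x\<in>carrier C. \<forall>y\<in>carrier C. \<forall>z\<in>carrier C.
        (rle C (x \<otimes>\<^bsub>C\<^esub> y) z \<longleftrightarrow> rle C y (lres C x z)) \<and>
        (rle C (x \<otimes>\<^bsub>C\<^esub> y) z \<longleftrightarrow> rle C x (rres C z y))"
    using res[OF SB' SB' SB'] by simp blast
  moreover have "\<forall>u1\<in>carrier C. \<forall>u2\<in>carrier C. \<forall>z\<in>carrier C. \<forall>w\<in>carrier C.
        rle C u1 u2 \<or> rle C u2 u1 \<or> (rle C (rmeet C u1 u2) w \<and> rle C z (rjoin C u1 u2))"
    using uni[OF SB' SB' SB' SB'] by simp blast
  ultimately have "C \<in> URL"
    unfolding URL_def RL_def mem_Collect_eq by (intro conjI)
  moreover have ev: "eval C (f \<circ> \<rho>) t = f (eval B \<rho> t)" for t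
    by (induction t) (simp_all add: inS)
  have "\<not> satisfies C e"
  proof
    assume "satisfies C e"
    moreover have "\<forall>n. (f \<circ> \<rho>) n \<in> carrier C"
      using inS[of "Var _"] by simp
    ultimately have "f (eval B \<rho> (fst e)) = f (eval B \<rho> (snd e))"
      unfolding satisfies_def ev[symmetric] by blast
    then show False
      using ne by (simp add: inS)
  qed
  ultimately show ?thesis
    by blast
qed

end

theory Submission
  imports Defs
begin

text \<open>
  The variety generated by \<open>URL\<close> consists of the algebras that satisfy every equation valid in
  \<open>URL\<close>.  One inclusion only needs that residuated lattices form an equational class
  (\<open>RL_eq_Mod\<close>) and that the equations hold in unilinear residuated lattices: for given \<open>x, y\<close>,
  unilinearity makes one of the three joinands the conjugate of an element above \<open>1\<close>, which
  is \<open>1\<close>, while every conjugate lies below \<open>1\<close>.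

  For the other inclusion, suppose that a residuated lattice \<open>A\<close> satisfies the equations and
  refutes an equation, with values \<open>s \<noteq> t\<close> of its two sides.  It suffices to find a
  unilinear quotient of \<open>A\<close> in which \<open>s\<close> and \<open>t\<close> stay distinct.  Congruences of \<open>A\<close> correspond to
  convex normal submonoids of the negative cone, and \<open>s, t\<close> are identified exactly if the
  submonoid contains \<open>u = (s\t) \<and> (t\s) \<and> 1\<close>.  Zorn's lemma gives a maximal such submonoid \<open>M\<close> that
  avoids \<open>u\<close>.  If the quotient by \<open>M\<close> is not unilinear, witnessed by \<open>x, y\<close> and, say, \<open>z\<close>,
  then none of \<open>a = x\y\<close>, \<open>b = y\x\<close>, \<open>c = (x \<and> y)\z\<close> is above an element of \<open>M\<close>, so by maximality
  adjoining any one of them to \<open>M\<close> captures \<open>u\<close>.  An element that is captured in this way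
  lies above a product of elements of \<open>M\<close> and iterated conjugates of the adjoined element.
  The equations say that iterated conjugates of \<open>a, b, c\<close> join to \<open>1\<close>.  In the negative cone,
  the condition that the join with a fixed element lies in \<open>M\<close> passes to products
  (\<open>extension_join_in\<close>), so all joins of captured elements from the three sides lie in \<open>M\<close>
  (\<open>extension3_inter\<close>).  In particular the join of \<open>u\<close> with itself does, a contradiction.
\<close>

section \<open>Residuated lattices and their equations\<close>

locale lattice_algebra =
  fixes A :: "'u rl" (structure)
  assumes alg: "rl_algebra A" and lat: "lattice_laws A"
begin

abbreviation le (infix "\<preceq>" 50) where "x \<preceq> y \<equiv> rle A x y"
abbreviation times (infixl "\<cdot>" 70) where "x \<cdot> y \<equiv> x \<otimes> y"
abbreviation meet (infixl "\<^bold>\<and>" 65) where "x \<^bold>\<and> y \<equiv> rmeet A x y"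
abbreviation join (infixl "\<^bold>\<or>" 65) where "x \<^bold>\<or> y \<equiv> rjoin A x y"
abbreviation under (infix "\<rightharpoonup>" 68) where "x \<rightharpoonup> z \<equiv> lres A x z"
abbreviation over (infix "\<leftharpoondown>" 68) where "z \<leftharpoondown> y \<equiv> rres A z y"

lemma closed [simp, intro]:
  "\<one> \<in> carrier A"
  "\<lbrakk>x \<in> carrier A; y \<in> carrier A\<rbrakk> \<Longrightarrow> x \<cdot> y \<in> carrier A"
  "\<lbrakk>x \<in> carrier A; y \<in> carrier A\<rbrakk> \<Longrightarrow> x \<^bold>\<and> y \<in> carrier A"
  "\<lbrakk>x \<in> carrier A; y \<in> carrier A\<rbrakk> \<Longrightarrow> x \<^bold>\<or> y \<in> carrier A"
  "\<lbrakk>x \<in> carrier A; y \<in> carrier A\<rbrakk> \<Longrightarrow> x \<rightharpoonup> y \<in> carrier A"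
  "\<lbrakk>x \<in> carrier A; y \<in> carrier A\<rbrakk> \<Longrightarrow> x \<leftharpoondown> y \<in> carrier A"
  using alg by (auto simp: rl_algebra_def)

lemma meet_comm: "\<lbrakk>x \<in> carrier A; y \<in> carrier A\<rbrakk> \<Longrightarrow> x \<^bold>\<and> y = y \<^bold>\<and> x"
  and join_comm: "\<lbrakk>x \<in> carrier A; y \<in> carrier A\<rbrakk> \<Longrightarrow> x \<^bold>\<or> y = y \<^bold>\<or> x"
  and meet_join_absorb: "\<lbrakk>x \<in> carrier A; y \<in> carrier A\<rbrakk> \<Longrightarrow> x \<^bold>\<and> (x \<^bold>\<or> y) = x"
  and join_meet_absorb: "\<lbrakk>x \<in> carrier A; y \<in> carrier A\<rbrakk> \<Longrightarrow> x \<^bold>\<or> (x \<^bold>\<and> y) = x"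
  using lat by (auto simp: lattice_laws_def)

lemma meet_assoc: "\<lbrakk>x \<in> carrier A; y \<in> carrier A; z \<in> carrier A\<rbrakk> \<Longrightarrow> x \<^bold>\<and> y \<^bold>\<and> z = x \<^bold>\<and> (y \<^bold>\<and> z)"
  and join_assoc: "\<lbrakk>x \<in> carrier A; y \<in> carrier A; z \<in> carrier A\<rbrakk> \<Longrightarrow> x \<^bold>\<or> y \<^bold>\<or> z = x \<^bold>\<or> (y \<^bold>\<or> z)"
  using lat unfolding lattice_laws_def by blast+

lemma meet_idem: "x \<in> carrier A \<Longrightarrow> x \<^bold>\<and> x = x"
  by (metis closed(3) join_meet_absorb meet_join_absorb)

lemma le_iff_join: "\<lbrakk>x \<in> carrier A; y \<in> carrier A\<rbrakk> \<Longrightarrow> x \<preceq> y \<longleftrightarrow> x \<^bold>\<or> y = y"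
  unfolding rle_def by (metis join_comm join_meet_absorb meet_comm meet_join_absorb)

lemma le_refl [simp]: "x \<in> carrier A \<Longrightarrow> x \<preceq> x"
  by (simp add: rle_def meet_idem)

lemma le_trans [trans]:
  "\<lbrakk>x \<preceq> y; y \<preceq> z; x \<in> carrier A; y \<in> carrier A; z \<in> carrier A\<rbrakk> \<Longrightarrow> x \<preceq> z"
  unfolding rle_def by (metis meet_assoc)

lemma le_antisym: "\<lbrakk>x \<preceq> y; y \<preceq> x; x \<in> carrier A; y \<in> carrier A\<rbrakk> \<Longrightarrow> x = y"
  unfolding rle_def by (metis meet_comm)

lemma meet_le1 [simp]: "\<lbrakk>x \<in> carrier A; y \<in> carrier A\<rbrakk> \<Longrightarrow> x \<^bold>\<and> y \<preceq> x"
  unfolding rle_def by (metis closed(3) meet_assoc meet_comm meet_idem)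

lemma meet_le2 [simp]: "\<lbrakk>x \<in> carrier A; y \<in> carrier A\<rbrakk> \<Longrightarrow> x \<^bold>\<and> y \<preceq> y"
  using meet_le1[of y x] by (simp add: meet_comm)

lemma le_meet_iff:
  assumes "x \<in> carrier A" "y \<in> carrier A" "z \<in> carrier A"
  shows "x \<preceq> y \<^bold>\<and> z \<longleftrightarrow> x \<preceq> y \<and> x \<preceq> z"
  using assms
  by (metis closed(3) le_trans meet_le1 meet_le2 meet_assoc rle_def)

lemma le_join1 [simp]: "\<lbrakk>x \<in> carrier A; y \<in> carrier A\<rbrakk> \<Longrightarrow> x \<preceq> x \<^bold>\<or> y"
  unfolding rle_def by (rule meet_join_absorb)

lemma le_join2 [simp]: "\<lbrakk>x \<in> carrier A; y \<in> carrier A\<rbrakk> \<Longrightarrow> y \<preceq> x \<^bold>\<or> y"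
  using le_join1[of y x] by (simp add: join_comm)

lemma join_le_iff:
  assumes "x \<in> carrier A" "y \<in> carrier A" "z \<in> carrier A"
  shows "x \<^bold>\<or> y \<preceq> z \<longleftrightarrow> x \<preceq> z \<and> y \<preceq> z"
  using assms
  by (metis closed(4) le_trans le_join1 le_join2 join_assoc le_iff_join)

end

locale residuated_lattice = lattice_algebra + monoid A +
  assumes under_iff:
    "\<lbrakk>x \<in> carrier A; y \<in> carrier A; z \<in> carrier A\<rbrakk> \<Longrightarrow> x \<cdot> y \<preceq> z \<longleftrightarrow> y \<preceq> x \<rightharpoonup> z"
  and over_iff:
    "\<lbrakk>x \<in> carrier A; y \<in> carrier A; z \<in> carrier A\<rbrakk> \<Longrightarrow> x \<cdot> y \<preceq> z \<longleftrightarrow> x \<preceq> z \<leftharpoondown> y"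

lemma RL_iff_residuated_lattice: "A \<in> RL \<longleftrightarrow> residuated_lattice A"
  by (auto simp: RL_def residuated_lattice_def residuated_lattice_axioms_def lattice_algebra_def)

context residuated_lattice
begin

lemma under_le: "\<lbrakk>x \<in> carrier A; z \<in> carrier A\<rbrakk> \<Longrightarrow> x \<cdot> (x \<rightharpoonup> z) \<preceq> z"
  by (simp add: under_iff)

lemma over_le: "\<lbrakk>x \<in> carrier A; z \<in> carrier A\<rbrakk> \<Longrightarrow> (z \<leftharpoondown> x) \<cdot> x \<preceq> z"
  by (simp add: over_iff)

lemma mult_mono_right:
  assumes "y \<preceq> z" "x \<in> carrier A" "y \<in> carrier A" "z \<in> carrier A"
  shows "x \<cdot> y \<preceq> x \<cdot> z"
proof -
  have "z \<preceq> x \<rightharpoonup> (x \<cdot> z)"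
    using assms under_iff[of x z "x \<cdot> z"] by simp
  then have "y \<preceq> x \<rightharpoonup> (x \<cdot> z)"
    using assms le_trans[of y z] by simp
  then show ?thesis
    using assms by (simp add: under_iff)
qed

lemma mult_mono_left:
  assumes "y \<preceq> z" "x \<in> carrier A" "y \<in> carrier A" "z \<in> carrier A"
  shows "y \<cdot> x \<preceq> z \<cdot> x"
proof -
  have "z \<preceq> (z \<cdot> x) \<leftharpoondown> x"
    using assms over_iff[of z x "z \<cdot> x"] by simp
  then have "y \<preceq> (z \<cdot> x) \<leftharpoondown> x"
    using assms le_trans[of y z] by simp
  then show ?thesis
    using assms by (simp add: over_iff)
qed

lemma mult_mono:
  assumes "x \<preceq> x'" "y \<preceq> y'" "x \<in> carrier A" "x' \<in> carrier A" "y \<in> carrier A" "y' \<in> carrier A"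
  shows "x \<cdot> y \<preceq> x' \<cdot> y'"
  using assms le_trans[OF mult_mono_left[of x x' y] mult_mono_right[of y y' x']] by simp

lemma under_mono:
  assumes "y \<preceq> z" "x \<in> carrier A" "y \<in> carrier A" "z \<in> carrier A"
  shows "x \<rightharpoonup> y \<preceq> x \<rightharpoonup> z"
  using assms under_le[of x y] le_trans[of "x \<cdot> (x \<rightharpoonup> y)" y z] under_iff[of x "x \<rightharpoonup> y" z] by simp

lemma over_mono:
  assumes "y \<preceq> z" "x \<in> carrier A" "y \<in> carrier A" "z \<in> carrier A"
  shows "y \<leftharpoondown> x \<preceq> z \<leftharpoondown> x"
  using assms over_le[of x y] le_trans[of "(y \<leftharpoondown> x) \<cdot> x" y z] over_iff[of "y \<leftharpoondown> x" x z] by simp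

lemma mult_join_le:
  assumes "x \<cdot> y \<preceq> w" "x \<cdot> z \<preceq> w" "x \<in> carrier A" "y \<in> carrier A" "z \<in> carrier A" "w \<in> carrier A"
  shows "x \<cdot> (y \<^bold>\<or> z) \<preceq> w"
  using assms by (simp add: under_iff join_le_iff)

lemma join_mult_le:
  assumes "y \<cdot> x \<preceq> w" "z \<cdot> x \<preceq> w" "x \<in> carrier A" "y \<in> carrier A" "z \<in> carrier A" "w \<in> carrier A"
  shows "(y \<^bold>\<or> z) \<cdot> x \<preceq> w"
  using assms by (simp add: over_iff join_le_iff)

lemma mult_le_left: "\<lbrakk>x \<preceq> \<one>; x \<in> carrier A; y \<in> carrier A\<rbrakk> \<Longrightarrow> x \<cdot> y \<preceq> y"
  using mult_mono_left[of x \<one> y] by simp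

lemma mult_le_right: "\<lbrakk>y \<preceq> \<one>; x \<in> carrier A; y \<in> carrier A\<rbrakk> \<Longrightarrow> x \<cdot> y \<preceq> x"
  using mult_mono_right[of y \<one> x] by simp

end

abbreviation leq_eqn :: "trm \<Rightarrow> trm \<Rightarrow> equation" where
  "leq_eqn s t \<equiv> (Meet s t, s)"

text \<open>
  The residuation equivalences are not equations.  They say that multiplication by \<open>x\<close> and
  division by \<open>x\<close> are adjoint maps, and an adjunction is equivalent to monotonicity of both maps
  together with the unit and counit inequalities, all of which are equations over a lattice.
\<close>

definition RL_equations :: "equation set" where
  "RL_equations = (let x = Var 0; y = Var 1; z = Var 2 in
    {(Meet x y, Meet y x), (Join x y, Join y x),
     (Meet (Meet x y) z, Meet x (Meet y z)), (Join (Join x y) z, Join x (Join y z)),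
     (Meet x (Join x y), x), (Join x (Meet x y), x),
     (Mult (Mult x y) z, Mult x (Mult y z)), (Mult One x, x), (Mult x One, x),
     leq_eqn (Mult x (LRes x y)) y, leq_eqn y (LRes x (Mult x y)),
     leq_eqn (Mult x y) (Mult x (Join y z)), leq_eqn (LRes x (Meet y z)) (LRes x z),
     leq_eqn (Mult (RRes y x) x) y, leq_eqn y (RRes (Mult y x) x),
     leq_eqn (Mult y x) (Mult (Join y z) x), leq_eqn (RRes (Meet y z) x) (RRes z x)})"

lemma (in residuated_lattice) satisfies_RL_equations:
  assumes "e \<in> RL_equations"
  shows "satisfies A e"
proof -
  have "eval A \<rho> (fst e) = eval A \<rho> (snd e)" if \<rho>: "\<forall>n. \<rho> n \<in> carrier A" for \<rho>
  proof -
    define x y z where "x = \<rho> 0" "y = \<rho> 1" "z = \<rho> 2"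
    have c [simp]: "\<rho> n \<in> carrier A" for n
      using \<rho> by blast
    have "x \<cdot> (x \<rightharpoonup> y) \<preceq> y" "y \<preceq> x \<rightharpoonup> (x \<cdot> y)" "(y \<leftharpoondown> x) \<cdot> x \<preceq> y" "y \<preceq> (y \<cdot> x) \<leftharpoondown> x"
      using under_iff[of x y "x \<cdot> y"] over_iff[of y x "y \<cdot> x"]
      by (simp_all add: under_le over_le x_y_z_def)
    moreover have "x \<cdot> y \<preceq> x \<cdot> (y \<^bold>\<or> z)" "y \<cdot> x \<preceq> (y \<^bold>\<or> z) \<cdot> x"
      "x \<rightharpoonup> (y \<^bold>\<and> z) \<preceq> x \<rightharpoonup> z" "(y \<^bold>\<and> z) \<leftharpoondown> x \<preceq> z \<leftharpoondown> x"
      by (simp_all add: mult_mono_left mult_mono_right under_mono over_mono x_y_z_def)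
    ultimately show ?thesis
      using assms unfolding rle_def
      by (auto simp: RL_equations_def x_y_z_def Let_def m_assoc meet_assoc join_assoc
          meet_join_absorb join_meet_absorb) (rule meet_comm join_comm; simp)+
  qed
  then show ?thesis
    by (simp add: satisfies_def)
qed

lemma residuated_lattice_if_satisfies_RL_equations:
  assumes alg: "rl_algebra A" and eqs: "\<forall>e\<in>RL_equations. satisfies A e"
  shows "residuated_lattice A"
proof -
  have sat: "\<forall>e\<in>RL_equations.
      eval A (\<lambda>n. if n = 0 then x else if n = 1 then y else z) (fst e)
      = eval A (\<lambda>n. if n = 0 then x else if n = 1 then y else z) (snd e)"
    if "x \<in> carrier A" "y \<in> carrier A" "z \<in> carrier A" for x y z
    using eqs that unfolding satisfies_def by simp
  have laws:
    "rmeet A x y = rmeet A y x \<and> rjoin A x y = rjoin A y x \<and>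
     rmeet A (rmeet A x y) z = rmeet A x (rmeet A y z) \<and>
     rjoin A (rjoin A x y) z = rjoin A x (rjoin A y z) \<and>
     rmeet A x (rjoin A x y) = x \<and> rjoin A x (rmeet A x y) = x"
    "(x \<otimes>\<^bsub>A\<^esub> y) \<otimes>\<^bsub>A\<^esub> z = x \<otimes>\<^bsub>A\<^esub> (y \<otimes>\<^bsub>A\<^esub> z) \<and> \<one>\<^bsub>A\<^esub> \<otimes>\<^bsub>A\<^esub> x = x \<and> x \<otimes>\<^bsub>A\<^esub> \<one>\<^bsub>A\<^esub> = x"
    "rle A (x \<otimes>\<^bsub>A\<^esub> lres A x y) y \<and> rle A y (lres A x (x \<otimes>\<^bsub>A\<^esub> y)) \<and>
     rle A (x \<otimes>\<^bsub>A\<^esub> y) (x \<otimes>\<^bsub>A\<^esub> rjoin A y z) \<and> rle A (lres A x (rmeet A y z)) (lres A x z)"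
    "rle A (rres A y x \<otimes>\<^bsub>A\<^esub> x) y \<and> rle A y (rres A (y \<otimes>\<^bsub>A\<^esub> x) x) \<and>
     rle A (y \<otimes>\<^bsub>A\<^esub> x) (rjoin A y z \<otimes>\<^bsub>A\<^esub> x) \<and> rle A (rres A (rmeet A y z) x) (rres A z x)"
    if "x \<in> carrier A" "y \<in> carrier A" "z \<in> carrier A" for x y z
    using sat[OF that, unfolded RL_equations_def Let_def, simplified]
    unfolding rle_def by blast+
  interpret lattice_algebra A
    using alg laws(1) by unfold_locales (simp_all add: lattice_laws_def)
  have mon: "monoid A"
    using laws(2) by (intro monoidI) auto
  have under: "x \<cdot> y \<preceq> z \<longleftrightarrow> y \<preceq> x \<rightharpoonup> z"
    if c: "x \<in> carrier A" "y \<in> carrier A" "z \<in> carrier A" for x y z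
  proof
    assume "x \<cdot> y \<preceq> z"
    then have "x \<rightharpoonup> (x \<cdot> y) \<preceq> x \<rightharpoonup> z"
      using laws(3)[of x "x \<cdot> y" z] c by (simp add: rle_def)
    then show "y \<preceq> x \<rightharpoonup> z"
      using laws(3)[of x y y] c le_trans[of y "x \<rightharpoonup> (x \<cdot> y)"] by simp
  next
    assume "y \<preceq> x \<rightharpoonup> z"
    then have "x \<cdot> y \<preceq> x \<cdot> (x \<rightharpoonup> z)"
      using laws(3)[of x y "x \<rightharpoonup> z"] c by (simp add: le_iff_join)
    then show "x \<cdot> y \<preceq> z"
      using laws(3)[of x z z] c le_trans[of "x \<cdot> y" "x \<cdot> (x \<rightharpoonup> z)"] by simp
  qed
  have over: "x \<cdot> y \<preceq> z \<longleftrightarrow> x \<preceq> z \<leftharpoondown> y"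
    if c: "x \<in> carrier A" "y \<in> carrier A" "z \<in> carrier A" for x y z
  proof
    assume "x \<cdot> y \<preceq> z"
    then have "(x \<cdot> y) \<leftharpoondown> y \<preceq> z \<leftharpoondown> y"
      using laws(4)[of y "x \<cdot> y" z] c by (simp add: rle_def)
    then show "x \<preceq> z \<leftharpoondown> y"
      using laws(4)[of y x x] c le_trans[of x "(x \<cdot> y) \<leftharpoondown> y"] by simp
  next
    assume "x \<preceq> z \<leftharpoondown> y"
    then have "x \<cdot> y \<preceq> (z \<leftharpoondown> y) \<cdot> y"
      using laws(4)[of y x "z \<leftharpoondown> y"] c by (simp add: le_iff_join)
    then show "x \<cdot> y \<preceq> z"
      using laws(4)[of y z z] c le_trans[of "x \<cdot> y" "(z \<leftharpoondown> y) \<cdot> y"] by simp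
  qed
  interpret monoid A
    by (rule mon)
  show ?thesis
    using under over by unfold_locales
qed

lemma RL_eq_Mod: "(RL :: 'u rl set) = Mod RL_equations"
proof (intro equalityI subsetI)
  fix A :: "'u rl"
  assume "A \<in> RL"
  then show "A \<in> Mod RL_equations"
    using residuated_lattice.satisfies_RL_equations[of A]
    by (auto simp: Mod_def RL_iff_residuated_lattice) (simp add: RL_def flip: RL_iff_residuated_lattice)
next
  fix A :: "'u rl"
  assume "A \<in> Mod RL_equations"
  then show "A \<in> RL"
    using residuated_lattice_if_satisfies_RL_equations[of A]
    by (auto simp: Mod_def RL_iff_residuated_lattice)
qed

section \<open>Conjugates and unilinearity\<close>

context residuated_lattice
begin

definition left_conj :: "'a \<Rightarrow> 'a \<Rightarrow> 'a" where "left_conj g a = g \<rightharpoonup> (a \<cdot> g) \<^bold>\<and> \<one>"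
definition right_conj :: "'a \<Rightarrow> 'a \<Rightarrow> 'a" where "right_conj g a = (g \<cdot> a) \<leftharpoondown> g \<^bold>\<and> \<one>"

lemma conjugate_closed [simp, intro]:
  "\<lbrakk>g \<in> carrier A; a \<in> carrier A\<rbrakk> \<Longrightarrow> left_conj g a \<in> carrier A"
  "\<lbrakk>g \<in> carrier A; a \<in> carrier A\<rbrakk> \<Longrightarrow> right_conj g a \<in> carrier A"
  by (auto simp: left_conj_def right_conj_def)

lemma conjugate_le_one [simp]:
  "\<lbrakk>g \<in> carrier A; a \<in> carrier A\<rbrakk> \<Longrightarrow> left_conj g a \<preceq> \<one>"
  "\<lbrakk>g \<in> carrier A; a \<in> carrier A\<rbrakk> \<Longrightarrow> right_conj g a \<preceq> \<one>"
  by (simp_all add: left_conj_def right_conj_def)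

lemma le_conjugate_iff:
  assumes "g \<in> carrier A" "a \<in> carrier A" "p \<in> carrier A"
  shows "p \<preceq> left_conj g a \<longleftrightarrow> g \<cdot> p \<preceq> a \<cdot> g \<and> p \<preceq> \<one>"
    and "p \<preceq> right_conj g a \<longleftrightarrow> p \<cdot> g \<preceq> g \<cdot> a \<and> p \<preceq> \<one>"
proof -
  show "p \<preceq> left_conj g a \<longleftrightarrow> g \<cdot> p \<preceq> a \<cdot> g \<and> p \<preceq> \<one>"
    using assms by (simp add: left_conj_def le_meet_iff under_iff)
  show "p \<preceq> right_conj g a \<longleftrightarrow> p \<cdot> g \<preceq> g \<cdot> a \<and> p \<preceq> \<one>"
    using assms by (simp add: right_conj_def le_meet_iff over_iff)
qed

lemma mult_conjugate_le:
  assumes "g \<in> carrier A" "a \<in> carrier A"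
  shows "g \<cdot> left_conj g a \<preceq> a \<cdot> g" "right_conj g a \<cdot> g \<preceq> g \<cdot> a"
  using assms le_conjugate_iff[of g a "left_conj g a"] le_conjugate_iff[of g a "right_conj g a"] by simp_all

lemma conjugate_mono:
  assumes "a \<preceq> b" "g \<in> carrier A" "a \<in> carrier A" "b \<in> carrier A"
  shows "left_conj g a \<preceq> left_conj g b" "right_conj g a \<preceq> right_conj g b"
  using assms mult_conjugate_le[of g a]
    le_trans[OF _ mult_mono_left[of a b g], of "g \<cdot> left_conj g a"]
    le_trans[OF _ mult_mono_right[of a b g], of "right_conj g a \<cdot> g"]
  by (simp_all add: le_conjugate_iff)

text \<open>
  Conjugates of a product lie above the product of the conjugates.  Hence the up-closure of the
  products of all conjugates of an element is again closed under conjugation.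
\<close>

lemma conjugate_mult_le:
  assumes c: "g \<in> carrier A" "a \<in> carrier A" "b \<in> carrier A"
  shows "left_conj g a \<cdot> left_conj g b \<preceq> left_conj g (a \<cdot> b)" "right_conj g a \<cdot> right_conj g b \<preceq> right_conj g (a \<cdot> b)"
proof -
  have "left_conj g a \<cdot> left_conj g b \<preceq> \<one>" "right_conj g a \<cdot> right_conj g b \<preceq> \<one>"
    using c mult_mono[of "left_conj g a" \<one> "left_conj g b" \<one>]
      mult_mono[of "right_conj g a" \<one> "right_conj g b" \<one>] by simp_all
  moreover have "g \<cdot> (left_conj g a \<cdot> left_conj g b) \<preceq> a \<cdot> b \<cdot> g"
  proof -
    have "g \<cdot> left_conj g a \<cdot> left_conj g b \<preceq> a \<cdot> g \<cdot> left_conj g b"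
      using c by (intro mult_mono_left mult_conjugate_le) auto
    moreover have "a \<cdot> (g \<cdot> left_conj g b) \<preceq> a \<cdot> (b \<cdot> g)"
      using c by (intro mult_mono_right mult_conjugate_le) auto
    ultimately show ?thesis
      using c le_trans[of "g \<cdot> left_conj g a \<cdot> left_conj g b" "a \<cdot> g \<cdot> left_conj g b"] by (simp add: m_assoc)
  qed
  moreover have "right_conj g a \<cdot> right_conj g b \<cdot> g \<preceq> g \<cdot> (a \<cdot> b)"
  proof -
    have "right_conj g a \<cdot> (right_conj g b \<cdot> g) \<preceq> right_conj g a \<cdot> (g \<cdot> b)"
      using c by (intro mult_mono_right mult_conjugate_le) auto
    moreover have "right_conj g a \<cdot> g \<cdot> b \<preceq> g \<cdot> a \<cdot> b"
      using c by (intro mult_mono_left mult_conjugate_le) auto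
    ultimately show ?thesis
      using c le_trans[of "right_conj g a \<cdot> (right_conj g b \<cdot> g)" "right_conj g a \<cdot> (g \<cdot> b)"] by (simp add: m_assoc)
  qed
  ultimately show "left_conj g a \<cdot> left_conj g b \<preceq> left_conj g (a \<cdot> b)" "right_conj g a \<cdot> right_conj g b \<preceq> right_conj g (a \<cdot> b)"
    using c by (simp_all add: le_conjugate_iff)
qed

text \<open>
  The maps that iterated conjugates induce on \<open>A\<close>; \<open>X\<close> bounds the conjugating elements.
\<close>

inductive_set conjugations :: "'a set \<Rightarrow> ('a \<Rightarrow> 'a) set" for X where
  left: "g \<in> X \<Longrightarrow> left_conj g \<in> conjugations X"
| right: "g \<in> X \<Longrightarrow> right_conj g \<in> conjugations X"
| comp: "f \<in> conjugations X \<Longrightarrow> h \<in> conjugations X \<Longrightarrow> f \<circ> h \<in> conjugations X"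

lemma conjugations_mono: "f \<in> conjugations X \<Longrightarrow> X \<subseteq> Y \<Longrightarrow> f \<in> conjugations Y"
  by (induction rule: conjugations.induct) (auto intro: conjugations.intros)

text \<open>
  One assignment has to interpret all conjugating variables of an equation and \<open>x, y, z, w\<close> at
  the same time, and the carrier may be uncountable.  Finiteness of the support makes room for
  all of them in a single sequence of values.
\<close>

lemma conjugations_finite_support:
  assumes "f \<in> conjugations X"
  obtains Y where "finite Y" "Y \<subseteq> X" "f \<in> conjugations Y"
proof -
  have "\<exists>Y. finite Y \<and> Y \<subseteq> X \<and> f \<in> conjugations Y"
    using assms
  proof induction
    case (left g)
    then show ?case
      by (intro exI[of _ "{g}"]) (auto intro: conjugations.intros)
  next
    case (right g)
    then show ?case
      by (intro exI[of _ "{g}"]) (auto intro: conjugations.intros)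
  next
    case (comp f h)
    then obtain Y Z where "finite Y" "Y \<subseteq> X" "f \<in> conjugations Y" "finite Z" "Z \<subseteq> X"
      "h \<in> conjugations Z"
      by blast
    then show ?case
      using conjugations.comp[of f "Y \<union> Z" h] conjugations_mono[of f Y "Y \<union> Z"]
        conjugations_mono[of h Z "Y \<union> Z"]
      by (intro exI[of _ "Y \<union> Z"]) blast
  qed
  then show ?thesis
    using that by blast
qed

lemma conjugations_closed_le_one:
  assumes "f \<in> conjugations X" "X \<subseteq> carrier A" "a \<in> carrier A"
  shows "f a \<in> carrier A \<and> f a \<preceq> \<one>"
  using assms(1,3,2) by (induction arbitrary: a) auto

lemma conjugations_eq_one:
  assumes "f \<in> conjugations X" "X \<subseteq> carrier A" "a \<in> carrier A" "\<one> \<preceq> a"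
  shows "f a = \<one>"
  using assms(1,3,4,2)
proof (induction arbitrary: a)
  case (left g)
  then show ?case
    using mult_mono_left[of \<one> a g] by (intro le_antisym) (auto simp: le_conjugate_iff)
next
  case (right g)
  then show ?case
    using mult_mono_right[of \<one> a g] by (intro le_antisym) (auto simp: le_conjugate_iff)
qed simp

lemma eval_iterated_conjugate:
  assumes "\<gamma> \<in> iterated_conjugates"
  shows "\<exists>f\<in>conjugations (range \<rho>). \<forall>t. eval A \<rho> (\<gamma> t) = f (eval A \<rho> t)"
  using assms
proof induction
  case (left n)
  then show ?case
    by (intro bexI[of _ "left_conj (\<rho> n)"]) (auto simp: lconj_def left_conj_def intro: conjugations.intros)
next
  case (right n)
  then show ?case
    by (intro bexI[of _ "right_conj (\<rho> n)"]) (auto simp: rconj_def right_conj_def intro: conjugations.intros)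
next
  case (comp f g)
  then obtain f' g' where "f' \<in> conjugations (range \<rho>)" "g' \<in> conjugations (range \<rho>)"
    "\<forall>t. eval A \<rho> (f t) = f' (eval A \<rho> t)" "\<forall>t. eval A \<rho> (g t) = g' (eval A \<rho> t)"
    by blast
  then show ?case
    by (intro bexI[of _ "f' \<circ> g'"]) (auto intro: conjugations.intros)
qed

lemma conjugation_is_iterated_conjugate:
  assumes "f \<in> conjugations (range \<rho>)"
  shows "\<exists>\<gamma>\<in>iterated_conjugates. \<forall>t. eval A \<rho> (\<gamma> t) = f (eval A \<rho> t)"
  using assms
proof induction
  case (left g)
  then obtain n where "g = \<rho> n"
    by blast
  then show ?case
    by (intro bexI[of _ "lconj (Var n)"])
      (auto simp: lconj_def left_conj_def intro: iterated_conjugates.intros)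
next
  case (right g)
  then obtain n where "g = \<rho> n"
    by blast
  then show ?case
    by (intro bexI[of _ "rconj (Var n)"])
      (auto simp: rconj_def right_conj_def intro: iterated_conjugates.intros)
next
  case (comp f g)
  then obtain f' g' where "f' \<in> iterated_conjugates" "g' \<in> iterated_conjugates"
    "\<forall>t. eval A \<rho> (f' t) = f (eval A \<rho> t)" "\<forall>t. eval A \<rho> (g' t) = g (eval A \<rho> t)"
    by blast
  then show ?case
    by (intro bexI[of _ "f' \<circ> g'"]) (auto intro: iterated_conjugates.intros)
qed

lemma one_le_under_iff:
  "\<lbrakk>x \<in> carrier A; y \<in> carrier A\<rbrakk> \<Longrightarrow> \<one> \<preceq> x \<rightharpoonup> y \<longleftrightarrow> x \<preceq> y"
  using under_iff[of x \<one> y] by simp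

lemma join3_eq_one:
  assumes "a \<in> carrier A" "b \<in> carrier A" "c \<in> carrier A" "a \<preceq> \<one>" "b \<preceq> \<one>" "c \<preceq> \<one>"
    and "a = \<one> \<or> b = \<one> \<or> c = \<one>"
  shows "a \<^bold>\<or> b \<^bold>\<or> c = \<one>"
proof (rule le_antisym)
  show "a \<^bold>\<or> b \<^bold>\<or> c \<preceq> \<one>"
    using assms(1-6) by (simp add: join_le_iff)
  show "\<one> \<preceq> a \<^bold>\<or> b \<^bold>\<or> c"
    using assms by (metis closed(4) join_le_iff le_refl)
qed (use assms in auto)

lemma conjugations_join3_eq_one:
  assumes f: "f \<in> conjugations X" "g \<in> conjugations X" "h \<in> conjugations X" and X: "X \<subseteq> carrier A"
    and abc: "a \<in> carrier A" "b \<in> carrier A" "c \<in> carrier A"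
    and or: "\<one> \<preceq> a \<or> \<one> \<preceq> b \<or> \<one> \<preceq> c"
  shows "f a \<^bold>\<or> g b \<^bold>\<or> h c = \<one>"
  using assms conjugations_closed_le_one[OF _ X] conjugations_eq_one[OF _ X]
  by (intro join3_eq_one) auto

end

lemma URL_satisfies_srl_equations:
  assumes A: "A \<in> URL" and e: "e \<in> srl_equations"
  shows "satisfies A e"
proof -
  interpret residuated_lattice A
    using A by (simp add: URL_def flip: RL_iff_residuated_lattice)
  have "eval A \<rho> (fst e) = eval A \<rho> (snd e)" if \<rho>: "\<forall>n. \<rho> n \<in> carrier A" for \<rho>
  proof -
    have R: "range \<rho> \<subseteq> carrier A"
      using \<rho> by auto
    define x y z w where "x = \<rho> 0" "y = \<rho> 1" "z = \<rho> 2" "w = \<rho> 3"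
    have c [simp]: "x \<in> carrier A" "y \<in> carrier A" "z \<in> carrier A" "w \<in> carrier A"
      using \<rho> by (auto simp: x_y_z_w_def)
    have uni: "x \<preceq> y \<or> y \<preceq> x \<or> (x \<^bold>\<and> y \<preceq> z \<and> w \<preceq> x \<^bold>\<or> y)"
      using A c unfolding URL_def by blast
    have "\<one>\<^bsub>A\<^esub> = f (x \<rightharpoonup> y) \<^bold>\<or> g (y \<rightharpoonup> x) \<^bold>\<or> h ((x \<^bold>\<and> y) \<rightharpoonup> z)"
      "\<one>\<^bsub>A\<^esub> = f (x \<rightharpoonup> y) \<^bold>\<or> g (y \<rightharpoonup> x) \<^bold>\<or> h (w \<rightharpoonup> (x \<^bold>\<or> y))"
      if "f \<in> conjugations (range \<rho>)" "g \<in> conjugations (range \<rho>)" "h \<in> conjugations (range \<rho>)"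
      for f g h
      using conjugations_join3_eq_one[OF that R] uni by (auto simp: one_le_under_iff)
    note joins = this[unfolded x_y_z_w_def]
    from e obtain \<gamma>1 \<gamma>2 \<gamma>3 where \<gamma>: "\<gamma>1 \<in> iterated_conjugates"
      "\<gamma>2 \<in> iterated_conjugates" "\<gamma>3 \<in> iterated_conjugates"
      "e = srl_equation1 \<gamma>1 \<gamma>2 \<gamma>3 \<or> e = srl_equation2 \<gamma>1 \<gamma>2 \<gamma>3"
      by (auto simp: srl_equations_def)
    obtain f g h where f: "f \<in> conjugations (range \<rho>)" "g \<in> conjugations (range \<rho>)"
        "h \<in> conjugations (range \<rho>)"
      and ev: "\<forall>t. eval A \<rho> (\<gamma>1 t) = f (eval A \<rho> t)" "\<forall>t. eval A \<rho> (\<gamma>2 t) = g (eval A \<rho> t)"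
        "\<forall>t. eval A \<rho> (\<gamma>3 t) = h (eval A \<rho> t)"
      using \<gamma>(1-3)[THEN eval_iterated_conjugate[of _ \<rho>]] by blast
    show ?thesis
      using \<gamma>(4) joins[OF f, symmetric] ev
      by (auto simp: srl_equation1_def srl_equation2_def Let_def)
  qed
  then show ?thesis
    by (simp add: satisfies_def)
qed


section \<open>Normal filters and their quotients\<close>

text \<open>
  Normal filters are the convex normal submonoids of the negative cone; they are the classes of
  \<open>\<one>\<close>, restricted to the negative cone, under the congruences of \<open>A\<close>.
\<close>

locale normal_filter = residuated_lattice +
  fixes M
  assumes neg: "m \<in> M \<Longrightarrow> m \<in> carrier A \<and> m \<preceq> \<one>"
  and one_in: "\<one> \<in> M"
  and mult_in: "\<lbrakk>m \<in> M; n \<in> M\<rbrakk> \<Longrightarrow> m \<cdot> n \<in> M"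
  and up_in: "\<lbrakk>m \<in> M; m \<preceq> n; n \<in> carrier A; n \<preceq> \<one>\<rbrakk> \<Longrightarrow> n \<in> M"
  and left_conj_in: "\<lbrakk>m \<in> M; g \<in> carrier A\<rbrakk> \<Longrightarrow> left_conj g m \<in> M"
  and right_conj_in: "\<lbrakk>m \<in> M; g \<in> carrier A\<rbrakk> \<Longrightarrow> right_conj g m \<in> M"
begin

lemma in_carrier [simp]: "m \<in> M \<Longrightarrow> m \<in> carrier A"
  using neg by blast

lemma le_one [simp]: "m \<in> M \<Longrightarrow> m \<preceq> \<one>"
  using neg by blast

text \<open>
  The preorder \<open>x/M \<le> y/M\<close>.  Multipliers are handier than membership of \<open>x \<rightharpoonup> y \<^bold>\<and> \<one>\<close> in \<open>M\<close>:
  transitivity and compatibility become computations with products.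
\<close>

definition qle :: "'a \<Rightarrow> 'a \<Rightarrow> bool" where
  "qle x y \<longleftrightarrow> x \<in> carrier A \<and> y \<in> carrier A \<and> (\<exists>m\<in>M. m \<cdot> x \<preceq> y)"

lemma qleI: "\<lbrakk>m \<in> M; m \<cdot> x \<preceq> y; x \<in> carrier A; y \<in> carrier A\<rbrakk> \<Longrightarrow> qle x y"
  by (auto simp: qle_def)

text \<open>Conjugation moves a factor from \<open>M\<close> past \<open>x\<close>, so the preorder does not depend on the side.\<close>

lemma qle_iff_right: "qle x y \<longleftrightarrow> x \<in> carrier A \<and> y \<in> carrier A \<and> (\<exists>m\<in>M. x \<cdot> m \<preceq> y)"
proof (intro iffI; (elim conjE bexE)?)
  assume "qle x y"
  then obtain m where m: "m \<in> M" "m \<cdot> x \<preceq> y" and [simp]: "x \<in> carrier A" "y \<in> carrier A"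
    by (auto simp: qle_def)
  have "x \<cdot> left_conj x m \<preceq> y"
    using m le_trans[OF mult_conjugate_le(1)[of x m] m(2)] by simp
  then show "x \<in> carrier A \<and> y \<in> carrier A \<and> (\<exists>m\<in>M. x \<cdot> m \<preceq> y)"
    using m(1) left_conj_in by auto
next
  fix m assume m: "x \<in> carrier A" "y \<in> carrier A" "m \<in> M" "x \<cdot> m \<preceq> y"
  then have "right_conj x m \<cdot> x \<preceq> y"
    using le_trans[OF mult_conjugate_le(2)[of x m] m(4)] by simp
  then show "qle x y"
    using m by (intro qleI[OF right_conj_in]) auto
qed

lemma qle_if_le: "\<lbrakk>x \<preceq> y; x \<in> carrier A; y \<in> carrier A\<rbrakk> \<Longrightarrow> qle x y"
  using one_in by (intro qleI[of \<one>]) auto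

lemma qle_carrier: "qle x y \<Longrightarrow> x \<in> carrier A \<and> y \<in> carrier A"
  by (simp add: qle_def)

lemma qle_trans [trans]:
  assumes "qle x y" "qle y z"
  shows "qle x z"
proof -
  obtain m n where m: "m \<in> M" "n \<in> M" "m \<cdot> x \<preceq> y" "n \<cdot> y \<preceq> z"
    and [simp]: "x \<in> carrier A" "y \<in> carrier A" "z \<in> carrier A"
    using assms by (auto simp: qle_def)
  have "n \<cdot> (m \<cdot> x) \<preceq> n \<cdot> y"
    using m by (intro mult_mono_right) auto
  then have "n \<cdot> m \<cdot> x \<preceq> z"
    using m le_trans[of "n \<cdot> (m \<cdot> x)" "n \<cdot> y" z] by (simp add: m_assoc)
  then show ?thesis
    using m by (intro qleI[OF mult_in[of n m]]) auto
qed

lemma qle_mult_iff: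
  assumes "x \<in> carrier A" "y \<in> carrier A" "z \<in> carrier A"
  shows "qle (x \<cdot> y) z \<longleftrightarrow> qle y (x \<rightharpoonup> z)" and "qle (x \<cdot> y) z \<longleftrightarrow> qle x (z \<leftharpoondown> y)"
proof -
  show "qle (x \<cdot> y) z \<longleftrightarrow> qle y (x \<rightharpoonup> z)"
    using assms by (auto simp: qle_iff_right m_assoc under_iff)
  show "qle (x \<cdot> y) z \<longleftrightarrow> qle x (z \<leftharpoondown> y)"
    using assms by (auto simp: qle_def m_assoc[symmetric] over_iff)
qed

text \<open>
  Two inequalities modulo \<open>M\<close> hold with a common multiplier, namely the product of their
  multipliers: this is why meets and joins of \<open>A\<close> remain meets and joins for the preorder.
\<close>

lemma common_multiplier:
  assumes "qle x y" "qle x' y'"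
  obtains m where "m \<in> M" "m \<cdot> x \<preceq> y" "m \<cdot> x' \<preceq> y'"
proof -
  obtain m n where m: "m \<in> M" "n \<in> M" "m \<cdot> x \<preceq> y" "n \<cdot> x' \<preceq> y'"
    and [simp]: "x \<in> carrier A" "y \<in> carrier A" "x' \<in> carrier A" "y' \<in> carrier A"
    using assms by (auto simp: qle_def)
  have "m \<cdot> n \<preceq> m" "m \<cdot> n \<preceq> n"
    using m by (auto intro: mult_le_left mult_le_right)
  then have "m \<cdot> n \<cdot> x \<preceq> m \<cdot> x" "m \<cdot> n \<cdot> x' \<preceq> n \<cdot> x'"
    using m by (auto intro: mult_mono_left)
  then have "m \<cdot> n \<cdot> x \<preceq> y" "m \<cdot> n \<cdot> x' \<preceq> y'"
    using m le_trans[of "m \<cdot> n \<cdot> x" "m \<cdot> x" y] le_trans[of "m \<cdot> n \<cdot> x'" "n \<cdot> x'" y'] by simp_all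
  then show ?thesis
    using m that[of "m \<cdot> n"] mult_in by blast
qed

lemma qle_meet:
  assumes "qle x y" "qle x z"
  shows "qle x (y \<^bold>\<and> z)"
proof -
  obtain m where "m \<in> M" "m \<cdot> x \<preceq> y" "m \<cdot> x \<preceq> z"
    using assms by (rule common_multiplier)
  then show ?thesis
    using assms[THEN qle_carrier] by (intro qleI[of m]) (auto simp: le_meet_iff)
qed

lemma qle_join:
  assumes "qle x z" "qle y z"
  shows "qle (x \<^bold>\<or> y) z"
proof -
  obtain m where "m \<in> M" "m \<cdot> x \<preceq> z" "m \<cdot> y \<preceq> z"
    using assms by (rule common_multiplier)
  then show ?thesis
    using assms[THEN qle_carrier] by (intro qleI[of m] mult_join_le) auto
qed

definition qeq :: "'a \<Rightarrow> 'a \<Rightarrow> bool" where "qeq x y \<longleftrightarrow> qle x y \<and> qle y x"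

lemma qeq_carrier: "qeq x y \<Longrightarrow> x \<in> carrier A \<and> y \<in> carrier A"
  by (simp add: qeq_def qle_def)

lemma qle_mult_mono:
  assumes "qle x x'" "qle y y'"
  shows "qle (x \<cdot> y) (x' \<cdot> y')"
proof -
  have [simp]: "x \<in> carrier A" "y \<in> carrier A" "x' \<in> carrier A" "y' \<in> carrier A"
    using assms qle_carrier by blast+
  have "qle y' (x \<rightharpoonup> (x \<cdot> y'))" "qle x' ((x' \<cdot> y') \<leftharpoondown> y')"
    by (simp_all add: qle_if_le flip: qle_mult_iff)
  then have "qle (x \<cdot> y) (x \<cdot> y')" "qle (x \<cdot> y') (x' \<cdot> y')"
    using assms by (simp_all add: qle_mult_iff(1)[of x y] qle_mult_iff(2)[of x y'] qle_trans[of y y'] qle_trans[of x x'])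
  then show ?thesis
    by (rule qle_trans)
qed

lemma qle_under_mono:
  assumes "qle x' x" "qle y y'"
  shows "qle (x \<rightharpoonup> y) (x' \<rightharpoonup> y')"
proof -
  have [simp]: "x \<in> carrier A" "y \<in> carrier A" "x' \<in> carrier A" "y' \<in> carrier A"
    using assms qle_carrier by blast+
  have "qle (x' \<cdot> (x \<rightharpoonup> y)) (x \<cdot> (x \<rightharpoonup> y))"
    by (intro qle_mult_mono[OF assms(1)] qle_if_le) auto
  also have "qle (x \<cdot> (x \<rightharpoonup> y)) y"
    by (intro qle_if_le under_le) auto
  also note assms(2)
  finally show ?thesis
    by (simp add: qle_mult_iff(1))
qed

lemma qle_over_mono:
  assumes "qle x' x" "qle y y'"
  shows "qle (y \<leftharpoondown> x) (y' \<leftharpoondown> x')"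
proof -
  have [simp]: "x \<in> carrier A" "y \<in> carrier A" "x' \<in> carrier A" "y' \<in> carrier A"
    using assms qle_carrier by blast+
  have "qle ((y \<leftharpoondown> x) \<cdot> x') ((y \<leftharpoondown> x) \<cdot> x)"
    by (intro qle_mult_mono[OF _ assms(1)] qle_if_le) auto
  also have "qle ((y \<leftharpoondown> x) \<cdot> x) y"
    by (intro qle_if_le over_le) auto
  also note assms(2)
  finally show ?thesis
    by (simp add: qle_mult_iff(2))
qed

lemma qle_meet_mono: "\<lbrakk>qle x x'; qle y y'\<rbrakk> \<Longrightarrow> qle (x \<^bold>\<and> y) (x' \<^bold>\<and> y')"
  by (meson closed(3) meet_le1 meet_le2 qle_carrier qle_if_le qle_meet qle_trans)

lemma qle_join_mono: "\<lbrakk>qle x x'; qle y y'\<rbrakk> \<Longrightarrow> qle (x \<^bold>\<or> y) (x' \<^bold>\<or> y')"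
  by (meson closed(4) le_join1 le_join2 qle_carrier qle_if_le qle_join qle_trans)

lemma qeq_congruence:
  assumes "qeq x x'" "qeq y y'"
  shows "qeq (x \<cdot> y) (x' \<cdot> y')" "qeq (x \<^bold>\<and> y) (x' \<^bold>\<and> y')" "qeq (x \<^bold>\<or> y) (x' \<^bold>\<or> y')"
    "qeq (x \<rightharpoonup> y) (x' \<rightharpoonup> y')" "qeq (x \<leftharpoondown> y) (x' \<leftharpoondown> y')"
  using assms
  by (auto simp: qeq_def qle_mult_mono qle_meet_mono qle_join_mono qle_under_mono qle_over_mono)

definition cls :: "'a \<Rightarrow> 'a set" where "cls x = {y. qeq x y}"

definition rep :: "'a set \<Rightarrow> 'a" where "rep S = (SOME x. x \<in> S)"

definition quotient :: "'a set rl" where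
  "quotient = \<lparr>carrier = cls ` carrier A, mult = (\<lambda>S T. cls (rep S \<cdot> rep T)), one = cls \<one>,
     rmeet = (\<lambda>S T. cls (rep S \<^bold>\<and> rep T)), rjoin = (\<lambda>S T. cls (rep S \<^bold>\<or> rep T)),
     lres = (\<lambda>S T. cls (rep S \<rightharpoonup> rep T)), rres = (\<lambda>S T. cls (rep S \<leftharpoondown> rep T))\<rparr>"

lemma cls_eq_iff:
  assumes "x \<in> carrier A" "y \<in> carrier A"
  shows "cls x = cls y \<longleftrightarrow> qeq x y"
proof
  assume "cls x = cls y"
  moreover have "y \<in> cls y"
    using assms by (simp add: cls_def qeq_def qle_if_le)
  ultimately show "qeq x y"
    by (auto simp: cls_def)
next
  assume "qeq x y"
  then show "cls x = cls y"
    unfolding cls_def qeq_def by (metis qle_trans)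
qed

lemma qeq_rep_cls: "x \<in> carrier A \<Longrightarrow> qeq (rep (cls x)) x"
proof -
  assume "x \<in> carrier A"
  then have "x \<in> cls x"
    by (simp add: cls_def qeq_def qle_if_le)
  then have "rep (cls x) \<in> cls x"
    unfolding rep_def by (rule someI)
  then show ?thesis
    by (simp add: cls_def qeq_def)
qed

lemma quotient_carrier: "carrier quotient = cls ` carrier A"
  by (simp add: quotient_def)

lemma quotient_simps:
  assumes "x \<in> carrier A" "y \<in> carrier A"
  shows "cls x \<otimes>\<^bsub>quotient\<^esub> cls y = cls (x \<cdot> y)" "\<one>\<^bsub>quotient\<^esub> = cls \<one>"
    "rmeet quotient (cls x) (cls y) = cls (x \<^bold>\<and> y)"
    "rjoin quotient (cls x) (cls y) = cls (x \<^bold>\<or> y)"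
    "lres quotient (cls x) (cls y) = cls (x \<rightharpoonup> y)"
    "rres quotient (cls x) (cls y) = cls (x \<leftharpoondown> y)"
proof -
  note q = qeq_rep_cls[OF assms(1)] qeq_rep_cls[OF assms(2)]
  note c = q[THEN qeq_carrier]
  show "cls x \<otimes>\<^bsub>quotient\<^esub> cls y = cls (x \<cdot> y)" "\<one>\<^bsub>quotient\<^esub> = cls \<one>"
    "rmeet quotient (cls x) (cls y) = cls (x \<^bold>\<and> y)"
    "rjoin quotient (cls x) (cls y) = cls (x \<^bold>\<or> y)"
    "lres quotient (cls x) (cls y) = cls (x \<rightharpoonup> y)"
    "rres quotient (cls x) (cls y) = cls (x \<leftharpoondown> y)"
    using c assms by (auto simp: quotient_def cls_eq_iff qeq_congruence[OF q])
qed

lemma rl_algebra_quotient: "rl_algebra quotient"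
  unfolding rl_algebra_def quotient_carrier
  by (auto simp: quotient_simps quotient_simps(2)[of \<one> \<one>])

lemma eval_quotient:
  assumes "\<forall>n. \<rho> n \<in> carrier A"
  shows "eval quotient (cls \<circ> \<rho>) t = cls (eval A \<rho> t)"
  using eval_in_carrier[OF alg assms]
  by (induction t) (simp_all add: quotient_simps quotient_simps(2)[of \<one> \<one>])

lemma satisfies_quotient:
  assumes "satisfies A e"
  shows "satisfies quotient e"
  unfolding satisfies_def
proof (intro allI impI)
  fix \<sigma> :: "nat \<Rightarrow> 'a set"
  assume "\<forall>n. \<sigma> n \<in> carrier quotient"
  then have "\<forall>n. \<exists>x. x \<in> carrier A \<and> \<sigma> n = cls x"
    by (auto simp: quotient_carrier)
  then obtain \<rho> where \<rho>: "\<forall>n. \<rho> n \<in> carrier A" "\<forall>n. \<sigma> n = cls (\<rho> n)"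
    by metis
  then have "\<sigma> = cls \<circ> \<rho>"
    by auto
  then show "eval quotient \<sigma> (fst e) = eval quotient \<sigma> (snd e)"
    using assms \<rho> by (simp add: eval_quotient satisfies_def)
qed

text \<open>
  Since residuated lattices form an equational class, no law has to be checked on classes modulo \<open>M\<close>.
\<close>

lemma quotient_in_RL: "quotient \<in> RL"
  unfolding RL_eq_Mod
  using rl_algebra_quotient satisfies_quotient satisfies_RL_equations by (auto simp: Mod_def)

lemma rle_quotient_iff:
  assumes c: "x \<in> carrier A" "y \<in> carrier A"
  shows "rle quotient (cls x) (cls y) \<longleftrightarrow> qle x y"
proof -
  have "rle quotient (cls x) (cls y) \<longleftrightarrow> qeq (x \<^bold>\<and> y) x"
    using c by (simp add: rle_def quotient_simps cls_eq_iff)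
  also have "\<dots> \<longleftrightarrow> qle x y"
    using c qle_if_le[of "x \<^bold>\<and> y" x] qle_if_le[of x x] qle_if_le[of "x \<^bold>\<and> y" y]
      qle_trans[of x "x \<^bold>\<and> y" y] qle_meet[of x x y]
    by (auto simp: qeq_def)
  finally show ?thesis .
qed

lemma meet_one_in_iff: "x \<in> carrier A \<Longrightarrow> x \<^bold>\<and> \<one> \<in> M \<longleftrightarrow> (\<exists>m\<in>M. m \<preceq> x)"
  by (metis closed(1,3) in_carrier le_meet_iff le_one meet_le1 meet_le2 up_in)

lemma qle_iff_under_in:
  assumes "x \<in> carrier A" "y \<in> carrier A"
  shows "qle x y \<longleftrightarrow> x \<rightharpoonup> y \<^bold>\<and> \<one> \<in> M"
  using assms by (auto simp: meet_one_in_iff qle_iff_right under_iff)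

text \<open>
  The normal filter generated by \<open>M\<close> and \<open>a \<^bold>\<and> \<one>\<close>.  Iterated conjugates are compositions of at
  least one conjugation, so \<open>a \<^bold>\<and> \<one>\<close> itself enters as the conjugate of \<open>a\<close> by \<open>\<one>\<close>.
\<close>

inductive_set extension :: "'a \<Rightarrow> 'a set" for a where
  base: "m \<in> M \<Longrightarrow> m \<in> extension a"
| conj: "f \<in> conjugations (carrier A) \<Longrightarrow> f a \<in> extension a"
| mult: "\<lbrakk>p \<in> extension a; q \<in> extension a\<rbrakk> \<Longrightarrow> p \<cdot> q \<in> extension a"
| up: "\<lbrakk>p \<in> extension a; p \<preceq> q; q \<in> carrier A; q \<preceq> \<one>\<rbrakk> \<Longrightarrow> q \<in> extension a"

lemma extension_neg:
  assumes "p \<in> extension a" "a \<in> carrier A"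
  shows "p \<in> carrier A \<and> p \<preceq> \<one>"
  using assms
proof induction
  case (mult p q)
  then show ?case
    using mult_mono[of p \<one> q \<one>] by simp
qed (auto dest: conjugations_closed_le_one)

lemma extension_conjugate:
  assumes "p \<in> extension a" "a \<in> carrier A" "g \<in> carrier A"
  shows "left_conj g p \<in> extension a \<and> right_conj g p \<in> extension a"
  using assms
proof induction
  case (base m)
  then show ?case
    by (simp add: extension.base left_conj_in right_conj_in)
next
  case (conj f)
  then have "left_conj g \<circ> f \<in> conjugations (carrier A)" "right_conj g \<circ> f \<in> conjugations (carrier A)"
    by (auto intro: conjugations.intros)
  then show ?case
    using extension.conj[of "left_conj g \<circ> f" a] extension.conj[of "right_conj g \<circ> f" a] by simp
next
  case (mult p q)
  then have c: "p \<in> carrier A" "q \<in> carrier A"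
    using extension_neg by blast+
  have "left_conj g p \<cdot> left_conj g q \<in> extension a" "right_conj g p \<cdot> right_conj g q \<in> extension a"
    using mult.IH mult.prems by (simp_all add: extension.mult)
  then show ?case
    using c mult.prems conjugate_mult_le[of g p q]
      extension.up[of "left_conj g p \<cdot> left_conj g q" a "left_conj g (p \<cdot> q)"]
      extension.up[of "right_conj g p \<cdot> right_conj g q" a "right_conj g (p \<cdot> q)"] by simp
next
  case (up p q)
  then have "p \<in> carrier A"
    using extension_neg by blast
  then show ?case
    using up conjugate_mono[of p q g] extension.up[of "left_conj g p" a "left_conj g q"]
      extension.up[of "right_conj g p" a "right_conj g q"] by simp
qed

lemma normal_filter_extension:
  assumes "a \<in> carrier A"
  shows "normal_filter A (extension a)"
proof unfold_locales
  show "\<one> \<in> extension a"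
    by (intro extension.base one_in)
  show "n \<in> extension a"
    if "m \<in> extension a" "m \<preceq> n" "n \<in> carrier A" "n \<preceq> \<one>" for m n
    using that by (rule extension.up)
qed (simp_all add: extension_neg extension_conjugate extension.mult assms)

lemma meet_one_in_extension:
  assumes "a \<in> carrier A"
  shows "a \<^bold>\<and> \<one> \<in> extension a"
proof -
  have "left_conj \<one> a \<in> extension a"
    by (intro extension.conj conjugations.left) simp
  moreover have "\<one> \<rightharpoonup> (a \<cdot> \<one>) \<preceq> a"
    using under_le[of \<one> a] assms by simp
  then have "left_conj \<one> a \<preceq> a \<^bold>\<and> \<one>"
    using assms le_trans[of "left_conj \<one> a" "\<one> \<rightharpoonup> (a \<cdot> \<one>)" a] by (simp add: le_meet_iff left_conj_def)
  ultimately show ?thesis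
    by (rule extension.up) (use assms in simp_all)
qed

text \<open>
  In the negative cone, \<open>p \<^bold>\<or> d\<close> and \<open>q \<^bold>\<or> d\<close> in \<open>M\<close> give \<open>(p \<^bold>\<or> d) \<cdot> (q \<^bold>\<or> d) \<preceq> p \<cdot> q \<^bold>\<or> d\<close>, so
  the condition \<open>p \<^bold>\<or> d \<in> M\<close> passes to products.
\<close>

lemma extension_join_in:
  assumes p: "p \<in> extension a" and a: "a \<in> carrier A" and d: "d \<in> carrier A" "d \<preceq> \<one>"
    and conj: "\<And>f. f \<in> conjugations (carrier A) \<Longrightarrow> f a \<^bold>\<or> d \<in> M"
  shows "p \<^bold>\<or> d \<in> M"
  using p
proof induction
  case (base m)
  then show ?case
    using d up_in[of m "m \<^bold>\<or> d"] by (simp add: join_le_iff)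
next
  case (conj f)
  then show ?case
    by (rule assms(5))
next
  case (mult p q)
  then have c [simp]: "p \<in> carrier A" "q \<in> carrier A" "p \<preceq> \<one>" "q \<preceq> \<one>"
    using extension_neg[OF _ a] by blast+
  have [simp]: "p \<cdot> q \<preceq> \<one>"
    using mult_mono[of p \<one> q \<one>] by simp
  have "p \<cdot> d \<preceq> p \<cdot> q \<^bold>\<or> d" "d \<cdot> (q \<^bold>\<or> d) \<preceq> p \<cdot> q \<^bold>\<or> d"
    using d le_trans[of "p \<cdot> d" d] le_trans[of "d \<cdot> (q \<^bold>\<or> d)" d]
    by (simp_all add: mult_le_left mult_le_right join_le_iff)
  then have "(p \<^bold>\<or> d) \<cdot> (q \<^bold>\<or> d) \<preceq> p \<cdot> q \<^bold>\<or> d"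
    using d by (intro join_mult_le mult_join_le[of p]) auto
  then show ?case
    using d up_in[OF mult_in[OF mult.IH], of "p \<cdot> q \<^bold>\<or> d"] by (simp add: join_le_iff)
next
  case (up p q)
  then have "p \<in> carrier A"
    using extension_neg[OF _ a] by blast
  then show ?case
    using up d up_in[of "p \<^bold>\<or> d" "q \<^bold>\<or> d"] le_trans[of p q "q \<^bold>\<or> d"] by (simp add: join_le_iff)
qed

text \<open>
  The three generators are replaced by \<open>u\<close> one at a time: from joins of conjugates of \<open>a, b, c\<close>
  to joins with \<open>u\<close> in place of \<open>h c\<close>, then of \<open>g b\<close>, then of \<open>f a\<close>.
\<close>

lemma extension3_inter:
  assumes abc: "a \<in> carrier A" "b \<in> carrier A" "c \<in> carrier A"
    and conj: "\<And>f g h. \<lbrakk>f \<in> conjugations (carrier A); g \<in> conjugations (carrier A);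
      h \<in> conjugations (carrier A)\<rbrakk> \<Longrightarrow> f a \<^bold>\<or> g b \<^bold>\<or> h c \<in> M"
    and u: "u \<in> extension a" "u \<in> extension b" "u \<in> extension c"
  shows "u \<in> M"
proof -
  note closed_neg = conjugations_closed_le_one[OF _ order_refl]
  have u': "u \<in> carrier A" "u \<preceq> \<one>"
    using u abc extension_neg by blast+
  have "f a \<^bold>\<or> (g b \<^bold>\<or> u) \<in> M"
    if fg: "f \<in> conjugations (carrier A)" "g \<in> conjugations (carrier A)" for f g
  proof -
    have "u \<^bold>\<or> (f a \<^bold>\<or> g b) \<in> M"
      using fg abc closed_neg u(3) conj[OF fg]
      by (intro extension_join_in[of u c]) (auto simp: join_le_iff join_comm)
    then show ?thesis
      using fg abc closed_neg u' by (simp add: join_comm[of u] join_assoc)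
  qed
  note fgu = this
  have "u \<^bold>\<or> (f a \<^bold>\<or> u) \<in> M" if f: "f \<in> conjugations (carrier A)" for f
  proof (rule extension_join_in[OF u(2) abc(2)])
    fix g assume g: "g \<in> conjugations (carrier A)"
    have "g b \<^bold>\<or> (f a \<^bold>\<or> u) = f a \<^bold>\<or> (g b \<^bold>\<or> u)"
      using abc u'(1) closed_neg[OF f abc(1)] closed_neg[OF g abc(2)]
      by (metis join_assoc join_comm)
    then show "g b \<^bold>\<or> (f a \<^bold>\<or> u) \<in> M"
      using fgu[OF f g] by simp
  qed (use f abc closed_neg u' in \<open>simp_all add: join_le_iff\<close>)
  then have "f a \<^bold>\<or> u \<in> M" if f: "f \<in> conjugations (carrier A)" for f
    using f abc closed_neg u' by (metis closed(4) join_comm join_le_iff le_iff_join le_join2)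
  then have "u \<^bold>\<or> u \<in> M"
    using abc u u' by (intro extension_join_in[of u a]) auto
  then show ?thesis
    using u' by (metis le_iff_join le_refl)
qed

end

section \<open>Quotients by maximal normal filters are unilinear\<close>

context residuated_lattice
begin

lemma normal_filter_one: "normal_filter A {\<one>}"
proof unfold_locales
  show "left_conj g m \<in> {\<one>}" "right_conj g m \<in> {\<one>}" if "m \<in> {\<one>}" "g \<in> carrier A" for m g
    using that conjugations_eq_one[OF conjugations.left, of g "{g}" \<one>]
      conjugations_eq_one[OF conjugations.right, of g "{g}" \<one>] by simp_all
  show "n \<in> {\<one>}" if "m \<in> {\<one>}" "m \<preceq> n" "n \<in> carrier A" "n \<preceq> \<one>" for m n
    using that le_antisym[of n \<one>] by simp
qed simp_all

lemma normal_filter_Union: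
  assumes "\<And>M. M \<in> \<C> \<Longrightarrow> normal_filter A M" "\<C> \<noteq> {}" "subset.chain UNIV \<C>"
  shows "normal_filter A (\<Union>\<C>)"
proof -
  show ?thesis
  proof unfold_locales
    show "m \<in> carrier A \<and> m \<preceq> \<one>" if "m \<in> \<Union>\<C>" for m
      using that normal_filter.neg[OF assms(1)] by blast
    show "\<one> \<in> \<Union>\<C>"
      using assms(2) normal_filter.one_in[OF assms(1)] by blast
    show "m \<cdot> n \<in> \<Union>\<C>" if m: "m \<in> \<Union>\<C>" "n \<in> \<Union>\<C>" for m n
    proof -
      obtain M N where MN: "M \<in> \<C>" "m \<in> M" "N \<in> \<C>" "n \<in> N"
        using m by blast
      then have "M \<subseteq> N \<or> N \<subseteq> M"
        using assms(3) by (simp add: subset_chain_def)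
      then show ?thesis
        using MN normal_filter.mult_in[OF assms(1)] by blast
    qed
    show "n \<in> \<Union>\<C>" if m: "m \<in> \<Union>\<C>" "m \<preceq> n" "n \<in> carrier A" "n \<preceq> \<one>" for m n
    proof -
      obtain M where "M \<in> \<C>" "m \<in> M"
        using m by blast
      then show ?thesis
        using m normal_filter.up_in[OF assms(1), of M m n] by blast
    qed
    show "left_conj g m \<in> \<Union>\<C>" "right_conj g m \<in> \<Union>\<C>" if "m \<in> \<Union>\<C>" "g \<in> carrier A" for m g
      using that normal_filter.left_conj_in[OF assms(1)] normal_filter.right_conj_in[OF assms(1)] by blast+
  qed
qed

lemma maximal_normal_filter_exists:
  assumes "u \<noteq> \<one>"
  obtains M where "normal_filter A M" "u \<notin> M"
    "\<forall>N. normal_filter A N \<longrightarrow> M \<subseteq> N \<longrightarrow> u \<notin> N \<longrightarrow> N = M"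
proof -
  define \<F> where "\<F> = {M. normal_filter A M \<and> u \<notin> M}"
  have "\<exists>M\<in>\<F>. \<forall>N\<in>\<F>. M \<subseteq> N \<longrightarrow> N = M"
  proof (rule subset_Zorn_nonempty)
    show "\<F> \<noteq> {}"
      using normal_filter_one assms by (auto simp: \<F>_def)
    fix \<C> assume "\<C> \<noteq> {}" "subset.chain \<F> \<C>"
    then show "\<Union>\<C> \<in> \<F>"
      using normal_filter_Union[of \<C>] by (fastforce simp: \<F>_def subset_chain_def)
  qed
  then show ?thesis
    using that by (auto simp: \<F>_def)
qed

text \<open>
  The assignment lists \<open>x, y, z, w\<close> first, where the equations expect them, and then the
  finitely many conjugating elements, so the variables of the latter can be chosen to differ
  from the former.  Later variables get the dummy value \<open>x\<close>.
\<close>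

lemma conjugations_term_realization:
  assumes f: "f \<in> conjugations (carrier A)" "g \<in> conjugations (carrier A)"
      "h \<in> conjugations (carrier A)"
    and x: "x \<in> carrier A" "y \<in> carrier A" "z \<in> carrier A" "w \<in> carrier A"
  obtains \<rho> \<gamma>1 \<gamma>2 \<gamma>3 where "\<forall>n. \<rho> n \<in> carrier A" "\<rho> 0 = x" "\<rho> 1 = y" "\<rho> 2 = z" "\<rho> 3 = w"
    "\<gamma>1 \<in> iterated_conjugates" "\<gamma>2 \<in> iterated_conjugates" "\<gamma>3 \<in> iterated_conjugates"
    "\<forall>t. eval A \<rho> (\<gamma>1 t) = f (eval A \<rho> t)" "\<forall>t. eval A \<rho> (\<gamma>2 t) = g (eval A \<rho> t)"
    "\<forall>t. eval A \<rho> (\<gamma>3 t) = h (eval A \<rho> t)"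
proof -
  obtain Y1 Y2 Y3 where Y: "finite Y1" "Y1 \<subseteq> carrier A" "f \<in> conjugations Y1"
    "finite Y2" "Y2 \<subseteq> carrier A" "g \<in> conjugations Y2"
    "finite Y3" "Y3 \<subseteq> carrier A" "h \<in> conjugations Y3"
    using f by (metis conjugations_finite_support)
  obtain gs where gs: "set gs = Y1 \<union> Y2 \<union> Y3"
    using Y finite_list[of "Y1 \<union> Y2 \<union> Y3"] by auto
  define vs where "vs = [x, y, z, w] @ gs"
  define \<rho> where "\<rho> n = (if n < length vs then vs ! n else x)" for n
  have set: "set vs \<subseteq> range \<rho>"
  proof
    fix v assume "v \<in> set vs"
    then obtain n where "n < length vs" "vs ! n = v"
      unfolding in_set_conv_nth by blast
    then show "v \<in> range \<rho>"
      by (intro image_eqI[of _ _ n]) (simp_all add: \<rho>_def)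
  qed
  have "set vs \<subseteq> carrier A"
    using gs Y x by (auto simp: vs_def)
  then have c: "\<forall>n. \<rho> n \<in> carrier A"
    using nth_mem[of _ vs] x by (auto simp: \<rho>_def)
  have "f \<in> conjugations (range \<rho>)" "g \<in> conjugations (range \<rho>)" "h \<in> conjugations (range \<rho>)"
    using Y gs set by (auto simp: vs_def intro: conjugations_mono)
  note this[THEN conjugation_is_iterated_conjugate]
  then obtain \<gamma>1 \<gamma>2 \<gamma>3 where \<gamma>:
    "\<gamma>1 \<in> iterated_conjugates" "\<gamma>2 \<in> iterated_conjugates" "\<gamma>3 \<in> iterated_conjugates"
    "\<forall>t. eval A \<rho> (\<gamma>1 t) = f (eval A \<rho> t)" "\<forall>t. eval A \<rho> (\<gamma>2 t) = g (eval A \<rho> t)"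
    "\<forall>t. eval A \<rho> (\<gamma>3 t) = h (eval A \<rho> t)"
    by (elim bexE) (rule that)
  have \<rho>: "\<rho> 0 = x" "\<rho> 1 = y" "\<rho> 2 = z" "\<rho> 3 = w"
    by (simp_all add: \<rho>_def vs_def numeral_3_eq_3 numeral_2_eq_2)
  show ?thesis
    by (rule that[OF c \<rho> \<gamma>])
qed

lemma srl_equations_conjugations:
  assumes sat: "\<forall>e\<in>srl_equations. satisfies A e"
    and f: "f \<in> conjugations (carrier A)" "g \<in> conjugations (carrier A)"
      "h \<in> conjugations (carrier A)"
    and x: "x \<in> carrier A" "y \<in> carrier A" "z \<in> carrier A" "w \<in> carrier A"
  shows "f (x \<rightharpoonup> y) \<^bold>\<or> g (y \<rightharpoonup> x) \<^bold>\<or> h ((x \<^bold>\<and> y) \<rightharpoonup> z) = \<one>"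
    and "f (x \<rightharpoonup> y) \<^bold>\<or> g (y \<rightharpoonup> x) \<^bold>\<or> h (w \<rightharpoonup> (x \<^bold>\<or> y)) = \<one>"
proof -
  obtain \<rho> \<gamma>1 \<gamma>2 \<gamma>3 where \<rho>: "\<forall>n. \<rho> n \<in> carrier A" "\<rho> 0 = x" "\<rho> 1 = y" "\<rho> 2 = z" "\<rho> 3 = w"
    and \<gamma>: "\<gamma>1 \<in> iterated_conjugates" "\<gamma>2 \<in> iterated_conjugates" "\<gamma>3 \<in> iterated_conjugates"
    and ev: "\<forall>t. eval A \<rho> (\<gamma>1 t) = f (eval A \<rho> t)" "\<forall>t. eval A \<rho> (\<gamma>2 t) = g (eval A \<rho> t)"
      "\<forall>t. eval A \<rho> (\<gamma>3 t) = h (eval A \<rho> t)"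
    by (rule conjugations_term_realization[OF f x])
  have "srl_equation1 \<gamma>1 \<gamma>2 \<gamma>3 \<in> srl_equations" "srl_equation2 \<gamma>1 \<gamma>2 \<gamma>3 \<in> srl_equations"
    using \<gamma> unfolding srl_equations_def by blast+
  note this[THEN sat[rule_format], unfolded satisfies_def, THEN spec, THEN mp, OF \<rho>(1), symmetric]
  then show "f (x \<rightharpoonup> y) \<^bold>\<or> g (y \<rightharpoonup> x) \<^bold>\<or> h ((x \<^bold>\<and> y) \<rightharpoonup> z) = \<one>"
    "f (x \<rightharpoonup> y) \<^bold>\<or> g (y \<rightharpoonup> x) \<^bold>\<or> h (w \<rightharpoonup> (x \<^bold>\<or> y)) = \<one>"
    using \<rho>(2-5) ev by (simp_all add: srl_equation1_def srl_equation2_def Let_def)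
qed

end

text \<open>
  If \<open>\<not> qle x y\<close>, then adjoining \<open>x \<rightharpoonup> y\<close> enlarges \<open>M\<close> and so captures \<open>u\<close>.  A failure of
  unilinearity at \<open>x, y\<close> amounts to three failures of this kind, and the equations make the three
  extensions meet in \<open>M\<close> only.
\<close>

lemma (in normal_filter) quotient_in_URL:
  assumes sat: "\<forall>e\<in>srl_equations. satisfies A e"
    and u: "u \<notin> M" and max: "\<forall>N. normal_filter A N \<longrightarrow> M \<subseteq> N \<longrightarrow> u \<notin> N \<longrightarrow> N = M"
  shows "quotient \<in> URL"
proof -
  have u_in: "u \<in> extension (x \<rightharpoonup> y)"
    if "x \<in> carrier A" "y \<in> carrier A" "\<not> qle x y" for x y
  proof (rule ccontr)
    assume "u \<notin> extension (x \<rightharpoonup> y)"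
    then have "extension (x \<rightharpoonup> y) = M"
      using that by (intro max[rule_format] normal_filter_extension) (auto intro: extension.base)
    then show False
      using that meet_one_in_extension[of "x \<rightharpoonup> y"] by (simp add: qle_iff_under_in)
  qed
  have "qle x y \<or> qle y x \<or> qle (x \<^bold>\<and> y) z \<and> qle w (x \<^bold>\<or> y)"
    if c: "x \<in> carrier A" "y \<in> carrier A" "z \<in> carrier A" "w \<in> carrier A" for x y z w
  proof (rule ccontr)
    assume neg: "\<not> ?thesis"
    then have ext: "u \<in> extension (x \<rightharpoonup> y)" "u \<in> extension (y \<rightharpoonup> x)"
      using c u_in by auto
    from neg consider "\<not> qle (x \<^bold>\<and> y) z" | "\<not> qle w (x \<^bold>\<or> y)"
      by blast
    then have "u \<in> M"
    proof cases
      case 1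
      then have "u \<in> extension ((x \<^bold>\<and> y) \<rightharpoonup> z)"
        using c by (intro u_in) auto
      then show ?thesis
        by (rule extension3_inter[rotated 4, OF ext])
          (use c in \<open>simp_all add: srl_equations_conjugations(1)[OF sat _ _ _ c] one_in\<close>)
    next
      case 2
      then have "u \<in> extension (w \<rightharpoonup> (x \<^bold>\<or> y))"
        using c by (intro u_in) auto
      then show ?thesis
        by (rule extension3_inter[rotated 4, OF ext])
          (use c in \<open>simp_all add: srl_equations_conjugations(2)[OF sat _ _ _ c] one_in\<close>)
    qed
    then show False
      using u by blast
  qed
  then show ?thesis
    using quotient_in_RL
    by (simp add: URL_def quotient_carrier quotient_simps rle_quotient_iff) blast
qed

lemma (in residuated_lattice) URL_refutes:
  assumes sat: "\<forall>e\<in>srl_equations. satisfies A e" and fail: "\<not> satisfies A e"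
  shows "\<exists>B :: 'a set rl. B \<in> URL \<and> \<not> satisfies B e"
proof -
  obtain \<rho> where \<rho>: "\<forall>n. \<rho> n \<in> carrier A" and ne: "eval A \<rho> (fst e) \<noteq> eval A \<rho> (snd e)"
    using fail by (auto simp: satisfies_def)
  define s t where st: "s = eval A \<rho> (fst e)" "t = eval A \<rho> (snd e)"
  have c [simp]: "s \<in> carrier A" "t \<in> carrier A"
    using \<rho> by (simp_all add: st eval_in_carrier[OF alg])
  define u where "u = (s \<rightharpoonup> t) \<^bold>\<and> (t \<rightharpoonup> s) \<^bold>\<and> \<one>"
  have "u \<noteq> \<one>"
  proof
    assume "u = \<one>"
    then have "\<one> \<preceq> (s \<rightharpoonup> t) \<^bold>\<and> (t \<rightharpoonup> s)"
      unfolding u_def by (metis c closed(1,3,5) meet_le1)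
    then have "s \<preceq> t" "t \<preceq> s"
      by (simp_all add: le_meet_iff one_le_under_iff)
    then show False
      using ne le_antisym[OF _ _ c] by (simp add: st)
  qed
  then obtain M where M: "normal_filter A M" "u \<notin> M"
    "\<forall>N. normal_filter A N \<longrightarrow> M \<subseteq> N \<longrightarrow> u \<notin> N \<longrightarrow> N = M"
    by (rule maximal_normal_filter_exists)
  interpret normal_filter A M
    by (rule M(1))
  have "\<not> satisfies quotient e"
  proof
    assume "satisfies quotient e"
    moreover have "\<forall>n. (cls \<circ> \<rho>) n \<in> carrier quotient"
      using \<rho> by (simp add: quotient_carrier)
    ultimately have "cls s = cls t"
      unfolding satisfies_def st eval_quotient[OF \<rho>, symmetric] by blast
    then have "qle \<one> (s \<rightharpoonup> t)" "qle \<one> (t \<rightharpoonup> s)"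
      by (simp_all add: cls_eq_iff qeq_def flip: qle_mult_iff)
    then have "qle \<one> ((s \<rightharpoonup> t) \<^bold>\<and> (t \<rightharpoonup> s))"
      by (rule qle_meet)
    then have "u \<in> M"
      by (auto simp: u_def meet_one_in_iff qle_def)
    then show False
      using M(2) by blast
  qed
  then show ?thesis
    using quotient_in_URL[OF sat M(2,3)] by blast
qed

section \<open>The axiomatization\<close>

text \<open>
  The quotient lives on sets of elements of \<open>A\<close>; since equations see only countable subalgebras,
  a refutation there can be moved back into the infinite universe \<open>'u\<close>.
\<close>

theorem corollary3p3:
  assumes "infinite (UNIV :: 'u set)"
  shows "(SRL :: 'u rl set) = {A \<in> RL. \<forall>e\<in>srl_equations. satisfies A e}"
proof
  have "{A \<in> RL :: 'u rl set. \<forall>e\<in>srl_equations. satisfies A e} = Mod (RL_equations \<union> srl_equations)"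
    by (auto simp: RL_eq_Mod Mod_def)
  then have "variety {A \<in> RL :: 'u rl set. \<forall>e\<in>srl_equations. satisfies A e}"
    by (auto simp: variety_def)
  moreover have "URL \<subseteq> {A \<in> RL :: 'u rl set. \<forall>e\<in>srl_equations. satisfies A e}"
    using URL_satisfies_srl_equations by (auto simp: URL_def)
  ultimately show "(SRL :: 'u rl set) \<subseteq> {A \<in> RL. \<forall>e\<in>srl_equations. satisfies A e}"
    by (auto simp: SRL_def generated_variety_def)
next
  show "{A \<in> RL. \<forall>e\<in>srl_equations. satisfies A e} \<subseteq> (SRL :: 'u rl set)"
  proof
    fix A :: "'u rl"
    assume A: "A \<in> {A \<in> RL. \<forall>e\<in>srl_equations. satisfies A e}"
    have "A \<in> Mod E" if URL: "URL \<subseteq> (Mod E :: 'u rl set)" for E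
    proof -
      have "satisfies A e" if "e \<in> E" for e
      proof (rule ccontr)
        assume "\<not> satisfies A e"
        then obtain B :: "'u set rl" where "B \<in> URL" "\<not> satisfies B e"
          using A residuated_lattice.URL_refutes[of A e] by (auto simp: RL_iff_residuated_lattice)
        then obtain C :: "'u rl" where "C \<in> URL" "\<not> satisfies C e"
          using URL_refute_in_universe[OF assms] by blast
        then show False
          using URL \<open>e \<in> E\<close> by (auto simp: Mod_def)
      qed
      then show ?thesis
        using A by (simp add: Mod_def RL_def)
    qed
    then show "A \<in> SRL"
      by (auto simp: SRL_def generated_variety_def variety_def)
  qed
qed

end
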